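(* Let $n\equiv 3\pmod 4$ be a positive integer and let $a$ be an indeterminate. Then \[ \sum_{k=0}^{(n-1)/2}\frac{(aq, q/a;q^2)_k\, (q^2;q^4)_k} {(aq^2, q^2/a;q^2)_k\, (q^4;q^4)_k}\, q^{2k}\equiv 0\pmod{\Phi_n(q)}. \]
   Context: Here $q$ and $a$ are indeterminates. For $x$ and a base $p$ (a power of $q$), $(x;p)_k=\prod_{j=0}^{k-1}(1-xp^j)$ and $(x_1,\dots,x_m;p)_k=(x_1;p)_k\cdots(x_m;p)_k$. $\Phi_n(q)$ is the $n$-th cyclotomic polynomial. For rational functions $A,B$ in $q$ and $a$ and a polynomial $P$, $A\equiv B\pmod{P}$ means that the numerator of the reduced form of $A-B$ is divisible by $P$ in the polynomial ring over $\mathbb{Z}$ in these variables (with denominators coprime to $P$). *)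

theory Defs
  imports
    Complex_Main
    "HOL-Computational_Algebra.Computational_Algebra"
    "HOL-Number_Theory.Totient"
begin

section \<open>Cyclotomic polynomials\<close>

definition cyclotomic :: "nat \<Rightarrow> int poly" where
  "cyclotomic n = (THE P. map_poly of_int P =
     (\<Prod>k\<in>totatives n. [:- cis (2 * pi * real k / real n), 1:]))"

text \<open>The description is well-defined: the product over the primitive roots of unity has
  integer coefficients.\<close>

lemma map_poly_of_int_add:
  "map_poly (of_int :: int \<Rightarrow> complex) (P + Q) = map_poly of_int P + map_poly of_int Q"
  by (rule poly_eqI) (simp add: coeff_map_poly)

lemma map_poly_of_int_mult:
  "map_poly (of_int :: int \<Rightarrow> complex) (P * Q) = map_poly of_int P * map_poly of_int Q"
  by (rule poly_eqI) (simp add: coeff_map_poly coeff_mult)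

lemma map_poly_of_int_prod:
  "map_poly (of_int :: int \<Rightarrow> complex) (\<Prod>x\<in>A. f x) = (\<Prod>x\<in>A. map_poly of_int (f x))"
  by (induction A rule: infinite_finite_induct) (simp_all add: map_poly_of_int_mult)

lemma map_poly_of_int_inj:
  assumes "map_poly (of_int :: int \<Rightarrow> complex) P = map_poly of_int Q"
  shows   "P = Q"
proof (rule poly_eqI)
  fix i
  from assms have "coeff (map_poly (of_int :: int \<Rightarrow> complex) P) i = coeff (map_poly of_int Q) i"
    by simp
  thus "coeff P i = coeff Q i" by (simp add: coeff_map_poly)
qed

lemma degree_map_poly_of_int: "degree (map_poly (of_int :: int \<Rightarrow> complex) P) = degree P"
  by (simp add: degree_map_poly)

lemma prod_roots_of_unity:
  assumes "n > 0"
  shows   "(\<Prod>k\<in>{0<..n}. [:- cis (2 * pi * real k / real n), 1:]) = monom 1 n - 1"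
    (is "?L = ?R")
proof -
  let ?f = "\<lambda>k. cis (2 * pi * real k / real n)"
  have "?f n = ?f 0" using assms by (simp add: cis.ctr)
  have *: "(\<Prod>k\<in>{0<..n}. [:- ?f k, 1:]) = (\<Prod>k<n. [:- ?f k, 1:])"
  proof -
    have "{0<..n} = insert n {0<..<n}" "{..<n} = insert 0 {0<..<n}"
      using assms by auto
    thus ?thesis using \<open>?f n = ?f 0\<close> by simp
  qed
  have bij: "bij_betw ?f {..<n} {z. z ^ n = 1}"
    by (rule bij_betw_roots_unity) fact
  have "(\<Prod>k<n. [:- ?f k, 1:]) = (\<Prod>z | z ^ n = 1. [:- z, 1:])"
    by (rule prod.reindex_bij_betw[OF bij, of "\<lambda>z. [:- z, 1:]"])
  also have "\<dots> = ?R"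
  proof (rule poly_eqI_degree_lead_coeff[where n = n and A = "{z. z ^ n = 1}"])
    have fin: "finite {z::complex. z ^ n = 1}"
      using assms by (intro finite_roots_unity) auto
    have card: "card {z::complex. z ^ n = 1} = n"
      using assms by (rule card_roots_unity_eq)
    show "card {z::complex. z ^ n = 1} \<ge> n" using card by simp
    have deg: "degree (\<Prod>z | z ^ n = (1::complex). [:- z, 1:]) = n"
      by (subst degree_prod_sum_eq) (simp_all add: card)
    show "degree (\<Prod>z | z ^ n = (1::complex). [:- z, 1:]) \<le> n" by (simp add: deg)
    show "degree (monom 1 n - 1 :: complex poly) \<le> n"
      by (rule degree_diff_le) (simp_all add: degree_monom_eq)
    have "lead_coeff (\<Prod>z | z ^ n = (1::complex). [:- z, 1:]) = 1"
      by (simp add: lead_coeff_prod)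
    thus "coeff (\<Prod>z | z ^ n = (1::complex). [:- z, 1:]) n = coeff (monom 1 n - 1) n"
      using assms by (simp add: deg)
    fix z :: complex assume z: "z \<in> {z. z ^ n = 1}"
    have "poly (\<Prod>z | z ^ n = (1::complex). [:- z, 1:]) z = 0"
      using z fin by (auto simp: poly_prod)
    thus "poly (\<Prod>z | z ^ n = (1::complex). [:- z, 1:]) z = poly (monom 1 n - 1) z"
      using z by (simp add: poly_monom)
  qed
  finally show ?thesis using * by simp
qed

lemma prod_primitive_roots:
  assumes "n > 0"
  shows   "(\<Prod>d | d dvd n. \<Prod>k\<in>totatives d. [:- cis (2 * pi * real k / real d), 1:]) = monom 1 n - 1"
proof -
  define A where "A = (\<lambda>d. {k\<in>{0<..n}. gcd k n = d})"
  let ?g = "\<lambda>k. [:- cis (2 * pi * real k / real n), 1:]"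
  have *: "(\<Prod>k\<in>A d. ?g k) =
             (\<Prod>k\<in>totatives (n div d). [:- cis (2 * pi * real k / real (n div d)), 1:])"
    if d: "d dvd n" for d
  proof -
    have "d > 0" using d assms by (auto intro: Nat.gr0I)
    have "(\<Prod>k\<in>A d. ?g k) = (\<Prod>k\<in>totatives (n div d). ?g (k * d))"
      using prod.reindex_bij_betw[OF bij_betw_totatives_gcd_eq[OF d assms], of ?g]
      by (simp add: A_def)
    also have "\<dots> = (\<Prod>k\<in>totatives (n div d). [:- cis (2 * pi * real k / real (n div d)), 1:])"
    proof (rule prod.cong)
      fix k
      have "2 * pi * real (k * d) / real n = 2 * pi * real k / real (n div d)"
        using \<open>d > 0\<close> d by (simp add: real_of_nat_div)
      thus "?g (k * d) = [:- cis (2 * pi * real k / real (n div d)), 1:]" by simp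
    qed simp
    finally show ?thesis .
  qed
  have "monom 1 n - 1 = (\<Prod>k\<in>{0<..n}. ?g k)"
    using prod_roots_of_unity[OF assms] by simp
  also have "{0<..n} = (\<Union>d\<in>{d. d dvd n}. A d)" by safe (auto simp: A_def)
  also have "(\<Prod>k\<in>\<dots>. ?g k) = (\<Prod>d | d dvd n. \<Prod>k\<in>A d. ?g k)"
    using assms by (intro prod.UNION_disjoint) (auto simp: A_def)
  also have "\<dots> = (\<Prod>d | d dvd n. \<Prod>k\<in>totatives (n div d). [:- cis (2 * pi * real k / real (n div d)), 1:])"
    by (intro prod.cong refl *) auto
  also have "\<dots> = (\<Prod>d | d dvd n. \<Prod>k\<in>totatives d. [:- cis (2 * pi * real k / real d), 1:])"
    by (rule prod.reindex_bij_betw[where h = "(div) n" and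
          g = "\<lambda>d. \<Prod>k\<in>totatives d. [:- cis (2 * pi * real k / real d), 1:]"],
        rule bij_betwI[where g = "(div) n"]) (use assms in \<open>auto elim!: dvdE\<close>)
  finally show ?thesis ..
qed

lemma cyclotomic_exists:
  "\<exists>P. map_poly of_int P = (\<Prod>k\<in>totatives n. [:- cis (2 * pi * real k / real n), 1:])"
proof (induction n rule: less_induct)
  case (less n)
  let ?C = "\<lambda>d. \<Prod>k\<in>totatives d. [:- cis (2 * pi * real k / real d), 1:]"
  show ?case
  proof (cases "n = 0")
    case True
    thus ?thesis by (intro exI[of _ 1]) simp
  next
    case False
    hence n: "n > 0" by simp
    from less obtain f where f: "\<And>d. d < n \<Longrightarrow> map_poly of_int (f d) = ?C d" by metis
    define D where "D = {d. d dvd n \<and> d < n}"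
    define M where "M = (\<Prod>d\<in>D. f d)"
    have fin: "finite {d. d dvd n}" using n by simp
    have D: "finite D" "{d. d dvd n} = insert n D" "n \<notin> D"
      using fin n by (auto simp: D_def dest: dvd_imp_le)
    have M: "map_poly of_int M = (\<Prod>d\<in>D. ?C d)"
      unfolding M_def map_poly_of_int_prod by (intro prod.cong refl f) (auto simp: D_def)
    have eq: "?C n * map_poly of_int M = monom 1 n - 1"
      using prod_primitive_roots[OF n] D unfolding M by simp
    have "lead_coeff (map_poly of_int M :: complex poly) = 1"
      unfolding M by (simp add: lead_coeff_prod)
    hence "of_int (lead_coeff M) = (1 :: complex)"
      by (simp add: degree_map_poly_of_int coeff_map_poly)
    hence lc: "lead_coeff M = 1" by simp
    hence "M \<noteq> 0" by auto
    obtain Q R where QR: "pseudo_divmod (monom 1 n - 1) M = (Q, R)" by fastforce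
    from pseudo_divmod[OF \<open>M \<noteq> 0\<close> QR] lc
    have 1: "monom 1 n - 1 = M * Q + R" and 2: "R = 0 \<or> degree R < degree M"
      by simp_all
    have "map_poly of_int (monom 1 n - 1 :: int poly) = (monom 1 n - 1 :: complex poly)"
      by (rule poly_eqI) (simp add: coeff_map_poly)
    hence "?C n * map_poly of_int M = map_poly of_int M * map_poly of_int Q + map_poly of_int R"
      using eq 1 by (simp add: map_poly_of_int_add map_poly_of_int_mult)
    hence 3: "map_poly of_int M * (?C n - map_poly of_int Q) = map_poly of_int R"
      by (simp add: algebra_simps)
    have "?C n - map_poly of_int Q = 0"
    proof (rule ccontr)
      assume nz: "?C n - map_poly of_int Q \<noteq> 0"
      have M0: "map_poly (of_int :: int \<Rightarrow> complex) M \<noteq> 0"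
        using \<open>M \<noteq> 0\<close> map_poly_of_int_inj[of M 0] by auto
      have "degree (map_poly (of_int :: int \<Rightarrow> complex) R) =
              degree (map_poly (of_int :: int \<Rightarrow> complex) M) + degree (?C n - map_poly of_int Q)"
        unfolding 3[symmetric] using nz M0 by (rule degree_mult_eq[rotated])
      hence "degree R \<ge> degree M" by (simp add: degree_map_poly_of_int)
      with 2 have "R = 0" by simp
      with 3 nz M0 show False by simp
    qed
    thus ?thesis by (intro exI[of _ Q]) simp
  qed
qed

lemma cyclotomic_eq_prod_roots:
  "map_poly of_int (cyclotomic n) = (\<Prod>k\<in>totatives n. [:- cis (2 * pi * real k / real n), 1:])"
proof -
  have "\<exists>!P. map_poly of_int P = (\<Prod>k\<in>totatives n. [:- cis (2 * pi * real k / real n), 1:])"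
    using cyclotomic_exists[of n] by (metis map_poly_of_int_inj)
  thus ?thesis unfolding cyclotomic_def by (rule theI')
qed


section \<open>Rational functions in two indeterminates\<close>

text \<open>The polynomial ring \<open>\<int>[q, a]\<close> is represented as \<open>\<int>[q][a]\<close>: in \<^typ>\<open>int poly poly\<close> the inner
  variable is \<open>q\<close> and the outer one is \<open>a\<close>, so that a polynomial \<open>p\<close> in \<open>q\<close> alone is \<open>[:p:]\<close>.\<close>

type_synonym ratfun = "int poly poly fract"

definition qvar :: ratfun where
  "qvar = Fract [:[:0, 1:]:] 1"

definition avar :: ratfun where
  "avar = Fract [:0, 1:] 1"

definition qpoch :: "'a :: comm_ring_1 \<Rightarrow> 'a \<Rightarrow> nat \<Rightarrow> 'a" where
  "qpoch x p k = (\<Prod>j<k. 1 - x * p ^ j)"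

text \<open>\<^const>\<open>quot_of_fract\<close> yields numerator and denominator of the reduced form.\<close>

definition ratfun_cong :: "ratfun \<Rightarrow> ratfun \<Rightarrow> int poly poly \<Rightarrow> bool" where
  "ratfun_cong A B P \<longleftrightarrow>
     P dvd fst (quot_of_fract (A - B)) \<and>
     coprime (snd (quot_of_fract A)) P \<and> coprime (snd (quot_of_fract B)) P"

end

(* At a primitive n-th root of unity the terms cancel in pairs. With
   g(x) = (1 - a x) (1 - x/a) (1 - x^2), consecutive terms satisfy
   t(k+1) / t(k) = q^2 g(q^(2k+1)) / g(q^(2k+2)), and g(1/x) = - g(x) / x^4. Since q^n = 1, this
   yields g(q^i) / g(q^j) = - q^(4i) for i + j = n. For n = 4m + 3 the central ratio
   t(m+1) / t(m) is therefore -1, and working outwards t(m+1+i) = - t(m-i).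
   The computation takes place in the localization of Z[q, a] at the denominators coprime
   to Phi_n(q), so that the irreducibility of Phi_n is not needed. *)

theory Submission
  imports Defs
begin

section \<open>Congruences in a localization\<close>

text \<open>Membership in the localization at the denominators coprime to \<open>P\<close>. The
  representation \<open>u / v\<close> need not be reduced, so closure under the ring operations
  follows by multiplying denominators.\<close>

definition regular_at :: "'a :: {ring_gcd, idom_divide, semiring_gcd_mult_normalize} \<Rightarrow> 'a fract \<Rightarrow> bool" where
  "regular_at P x \<longleftrightarrow> (\<exists>u v. v \<noteq> 0 \<and> coprime v P \<and> x = to_fract u / to_fract v)"

text \<open>Congruence modulo the ideal generated by \<open>P\<close> in the localization. Only the
  difference is constrained; \<open>x\<close> and \<open>y\<close> may themselves be non-regular,
  which is why the multiplication rules carry regularity hypotheses.\<close>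

definition cong_mod :: "'a :: {ring_gcd, idom_divide, semiring_gcd_mult_normalize} \<Rightarrow> 'a fract \<Rightarrow> 'a fract \<Rightarrow> bool" where
  "cong_mod P x y \<longleftrightarrow> (\<exists>z. regular_at P z \<and> x - y = to_fract P * z)"

lemma regular_at_to_fract [simp]: "regular_at P (to_fract u)"
  unfolding regular_at_def by (rule exI[of _ u], rule exI[of _ 1]) simp

lemma regular_at_0 [simp]: "regular_at P 0"
  and regular_at_1 [simp]: "regular_at P 1"
  using regular_at_to_fract[of P 0] regular_at_to_fract[of P 1] by simp_all

lemma regular_at_mult [intro]:
  assumes "regular_at P x" "regular_at P y"
  shows   "regular_at P (x * y)"
proof -
  from assms obtain u v u' v' where "v \<noteq> 0" "coprime v P" "x = to_fract u / to_fract v"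
    "v' \<noteq> 0" "coprime v' P" "y = to_fract u' / to_fract v'"
    unfolding regular_at_def by blast
  thus ?thesis unfolding regular_at_def
    by (intro exI[of _ "u * u'"] exI[of _ "v * v'"]) simp
qed

lemma regular_at_add [intro]:
  assumes "regular_at P x" "regular_at P y"
  shows   "regular_at P (x + y)"
proof -
  from assms obtain u v u' v' where "v \<noteq> 0" "coprime v P" "x = to_fract u / to_fract v"
    "v' \<noteq> 0" "coprime v' P" "y = to_fract u' / to_fract v'"
    unfolding regular_at_def by blast
  thus ?thesis unfolding regular_at_def
    by (intro exI[of _ "u * v' + u' * v"] exI[of _ "v * v'"]) (simp add: add_frac_eq)
qed

lemma regular_at_uminus [intro]: "regular_at P x \<Longrightarrow> regular_at P (- x)"
  using regular_at_mult[OF regular_at_to_fract[of P "-1"], of x] by simp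

lemma regular_at_diff [intro]: "regular_at P x \<Longrightarrow> regular_at P y \<Longrightarrow> regular_at P (x - y)"
  using regular_at_add[of P x "- y"] by auto

lemma regular_at_power [intro]: "regular_at P x \<Longrightarrow> regular_at P (x ^ k)"
  by (induction k) auto

lemma regular_at_prod [intro]:
  "(\<And>i. i \<in> A \<Longrightarrow> regular_at P (f i)) \<Longrightarrow> regular_at P (\<Prod>i\<in>A. f i)"
  by (induction A rule: infinite_finite_induct) auto

lemmas regular_at_intros = regular_at_mult regular_at_add regular_at_diff regular_at_uminus
  regular_at_power regular_at_prod

lemma regular_at_inverse_to_fract:
  "coprime v P \<Longrightarrow> regular_at P (inverse (to_fract v))"
\<comment> \<open>For \<open>v = 0\<close> the default value \<open>inverse 0 = 0\<close> is
  regular.\<close>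
proof (cases "v = 0")
  case False
  assume "coprime v P"
  thus ?thesis using False unfolding regular_at_def
    by (intro exI[of _ 1] exI[of _ v]) (simp add: inverse_eq_divide)
qed simp

lemma cong_mod_refl [simp]: "cong_mod P x x"
  unfolding cong_mod_def by (rule exI[of _ 0]) simp

lemma cong_mod_sym: "cong_mod P x y \<Longrightarrow> cong_mod P y x"
proof -
  assume "cong_mod P x y"
  then obtain z where "regular_at P z" "x - y = to_fract P * z" unfolding cong_mod_def by blast
  thus ?thesis unfolding cong_mod_def
    by (intro exI[of _ "- z"]) (auto simp flip: minus_diff_eq[of x y])
qed

lemma cong_mod_add:
  assumes "cong_mod P x x'" "cong_mod P y y'"
  shows   "cong_mod P (x + y) (x' + y')"
proof -
  from assms obtain z w where "regular_at P z" "x - x' = to_fract P * z"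
    "regular_at P w" "y - y' = to_fract P * w" unfolding cong_mod_def by blast
  thus ?thesis unfolding cong_mod_def
    by (intro exI[of _ "z + w"]) (auto simp: algebra_simps)
qed

lemma cong_mod_trans [trans]: "cong_mod P x y \<Longrightarrow> cong_mod P y z \<Longrightarrow> cong_mod P x z"
  using cong_mod_add[of P x y y z] by (simp add: cong_mod_def)

text \<open>The splitting x y - x' y' = (x - x') y + x' (y - y') decides which two of the four
  elements have to be regular.\<close>

lemma cong_mod_mult:
  assumes "cong_mod P x x'" "cong_mod P y y'" "regular_at P y" "regular_at P x'"
  shows   "cong_mod P (x * y) (x' * y')"
proof -
  from assms obtain z w where "regular_at P z" "x - x' = to_fract P * z"
    "regular_at P w" "y - y' = to_fract P * w" unfolding cong_mod_def by blast
  moreover have "x * y - x' * y' = (x - x') * y + x' * (y - y')" by (simp add: algebra_simps)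
  ultimately show ?thesis using assms(3,4) unfolding cong_mod_def
    by (intro exI[of _ "z * y + x' * w"]) (auto simp: distrib_left mult_ac)
qed

lemma cong_mod_mult_right:
  assumes "cong_mod P x x'" "regular_at P y"
  shows   "cong_mod P (x * y) (x' * y)"
proof -
  from assms(1) obtain z where "regular_at P z" "x - x' = to_fract P * z"
    unfolding cong_mod_def by blast
  moreover have "x * y - x' * y = (x - x') * y" by (simp add: algebra_simps)
  ultimately show ?thesis using assms(2) unfolding cong_mod_def
    by (intro exI[of _ "z * y"]) auto
qed

lemma cong_mod_uminus: "cong_mod P x x' \<Longrightarrow> cong_mod P (- x) (- x')"
  using cong_mod_mult_right[of P x x' "-1"] regular_at_uminus[of P 1] by simp

lemma cong_mod_diff: "cong_mod P x x' \<Longrightarrow> cong_mod P y y' \<Longrightarrow> cong_mod P (x - y) (x' - y')"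
  using cong_mod_add[of P x x' "-y" "-y'"] cong_mod_uminus[of P y y'] by simp

lemma cong_mod_power:
  assumes "cong_mod P x x'" "regular_at P x" "regular_at P x'"
  shows   "cong_mod P (x ^ k) (x' ^ k)"
  by (induction k) (use assms in \<open>auto intro!: cong_mod_mult\<close>)

lemma cong_mod_sum:
  "(\<And>i. i \<in> A \<Longrightarrow> cong_mod P (f i) (g i)) \<Longrightarrow> cong_mod P (\<Sum>i\<in>A. f i) (\<Sum>i\<in>A. g i)"
  by (induction A rule: infinite_finite_induct) (auto intro: cong_mod_add)

text \<open>Bridge to the reduced form r / s, for which r v = P u s. Since \<open>v\<close> is
  coprime to \<open>P\<close>, \<open>P\<close> divides r; since r is coprime to s, s divides
  \<open>v\<close> and inherits its coprimality to \<open>P\<close>.\<close>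

lemma ratfun_cong_0I:
  assumes "cong_mod P x 0"
  shows   "ratfun_cong x 0 P"
proof -
  from assms obtain u v where v: "v \<noteq> 0" "coprime v P"
    and x: "x = to_fract P * (to_fract u / to_fract v)"
    unfolding cong_mod_def regular_at_def by (auto simp del: times_divide_eq_right)
  define r s where "r = fst (quot_of_fract x)" and "s = snd (quot_of_fract x)"
  have s0: "s \<noteq> 0" by (simp add: s_def)
  have rs: "coprime r s" unfolding r_def s_def by (rule coprime_quot_of_fract)
  have "x = to_fract r / to_fract s"
    unfolding r_def s_def Fract_conv_to_fract[symmetric] by (rule Fract_quot_of_fract[symmetric])
  hence "to_fract r / to_fract s = to_fract (P * u) / to_fract v"
    using x by simp
  hence "to_fract (r * v) = to_fract (P * u * s)"
    using v s0 by (simp only: frac_eq_eq to_fract_eq_0_iff to_fract_mult not_False_eq_True)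
  hence eq: "r * v = P * u * s" unfolding to_fract_eq_iff .
  hence "P dvd r * v" by simp
  hence "P dvd r"
    using v(2) coprime_dvd_mult_left_iff[of P v r] coprime_commute[of P v] by blast
  moreover have "s dvd v * r" using eq by (simp add: mult.commute)
  hence "s dvd v"
    using rs coprime_dvd_mult_left_iff[of s r v] coprime_commute[of s r] by blast
  hence "coprime s P" using v(2) by (rule coprime_divisors[OF _ dvd_refl])
  ultimately show ?thesis by (simp add: ratfun_cong_def r_def s_def)
qed

section \<open>Divisibility and coprimality of cyclotomic polynomials\<close>

text \<open>Over the complex numbers the product of all Phi_d with d dividing n is X^n - 1;
  injectivity of the coefficient embedding brings this factorization down to the integers.\<close>

lemma cyclotomic_dvd:
  assumes "n > 0"
  shows   "cyclotomic n dvd monom 1 n - 1"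
proof -
  have "map_poly (of_int :: int \<Rightarrow> complex) (\<Prod>d | d dvd n. cyclotomic d) = monom 1 n - 1"
    using prod_primitive_roots[OF assms] by (simp add: map_poly_of_int_prod cyclotomic_eq_prod_roots)
  also have "\<dots> = map_poly of_int (monom 1 n - 1)"
    by (rule poly_eqI) (simp add: coeff_map_poly)
  finally have "(\<Prod>d | d dvd n. cyclotomic d) = monom 1 n - 1"
    by (rule map_poly_of_int_inj)
  thus ?thesis using assms by (metis dvd_prodI dvd_refl finite_divisors_nat mem_Collect_eq)
qed

lemma lead_coeff_cyclotomic: "lead_coeff (cyclotomic n) = 1"
proof -
  have "lead_coeff (map_poly (of_int :: int \<Rightarrow> complex) (cyclotomic n)) = 1"
    unfolding cyclotomic_eq_prod_roots by (simp add: lead_coeff_prod)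
  thus ?thesis by (simp add: degree_map_poly_of_int coeff_map_poly)
qed

lemma primitive_root_power_eq_1D:
  assumes "n > 0" "k \<in> totatives n" "cis (2 * pi * real k / real n) ^ m = 1"
  shows   "n dvd m"
proof -
  have "cis (real m * (2 * pi * real k / real n)) = 1"
    using assms(3) by (simp add: DeMoivre)
  hence "cos (real m * (2 * pi * real k / real n)) = 1"
    by (simp add: complex_eq_iff)
  then obtain j :: int where "real m * (2 * pi * real k / real n) = of_int j * 2 * pi"
    by (auto simp: cos_one_2pi_int)
  hence "real m * real k = of_int j * real n" using assms(1) by (simp add: field_simps)
  hence "of_int (int m * int k) = (of_int (j * int n) :: real)" by simp
  hence "int m * int k = j * int n" by (simp only: of_int_eq_iff)
  hence "int n dvd int (m * k)" by simp
  hence "n dvd m * k" by (simp only: int_dvd_int_iff)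
  moreover have "coprime k n" using assms(2) by (simp add: totatives_def)
  ultimately show ?thesis
    using coprime_dvd_mult_left_iff[of n k m] coprime_commute[of n k] by blast
qed

text \<open>A nonconstant common divisor would have a complex root, which would be a primitive n-th
  root of unity with m-th power 1. A constant one divides the leading coefficient 1 of Phi_n and so
  is a unit.\<close>

lemma coprime_monom_diff_cyclotomic:
  assumes "n > 0" "\<not> n dvd m"
  shows   "coprime (1 - monom 1 m) (cyclotomic n)"
proof (rule coprimeI)
  fix d assume d: "d dvd 1 - monom 1 m" "d dvd cyclotomic n"
  from d(2) obtain e where e: "cyclotomic n = d * e" ..
  have lc: "lead_coeff d dvd 1"
    using lead_coeff_cyclotomic[of n] unfolding e lead_coeff_mult by (metis dvd_triv_left)
  have "degree d = 0"
  proof (rule ccontr)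
    assume "degree d \<noteq> 0"
    hence "\<not> constant (poly (map_poly of_int d :: complex poly))"
      by (simp add: constant_degree degree_map_poly_of_int)
    then obtain z :: complex where z: "poly (map_poly of_int d) z = 0"
      using fundamental_theorem_of_algebra by blast
    from d(1) obtain f where "1 - monom 1 m = d * f" ..
    hence "map_poly of_int (1 - monom 1 m :: int poly) = map_poly (of_int :: int \<Rightarrow> complex) d * map_poly of_int f"
      by (simp add: map_poly_of_int_mult)
    moreover have "map_poly of_int (1 - monom 1 m :: int poly) = (1 - monom 1 m :: complex poly)"
      by (rule poly_eqI) (simp add: coeff_map_poly)
    ultimately have "poly (1 - monom 1 m) z = 0" using z by simp
    hence zm: "z ^ m = 1" by (simp add: poly_monom)
    have "poly (map_poly of_int (cyclotomic n)) z = 0"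
      using z by (simp add: e map_poly_of_int_mult)
    hence "\<exists>k\<in>totatives n. z = cis (2 * pi * real k / real n)"
      by (auto simp: cyclotomic_eq_prod_roots poly_prod)
    thus False using zm assms primitive_root_power_eq_1D by blast
  qed
  then obtain b where "d = [:b:]" by (rule degree_eq_zeroE)
  thus "d dvd 1" using lc by (simp add: is_unit_const_poly_iff)
qed

text \<open>A divisor of the nonzero constant \<open>c\<close> is itself constant, so it divides
  every coefficient of \<open>p\<close>; a single coefficient coprime to \<open>c\<close> then makes
  it a unit.\<close>

lemma coprime_const_polyI:
  fixes p :: "'a :: {ring_gcd, idom_divide, semiring_gcd_mult_normalize} poly"
  assumes "c \<noteq> 0" "coprime (coeff p i) c"
  shows   "coprime p [:c:]"
proof (rule coprimeI)
  fix d assume d: "d dvd p" "d dvd [:c:]"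
  from d(2) assms(1) have "degree d = 0" using dvd_imp_degree_le[of d "[:c:]"] by simp
  then obtain b where b: "d = [:b:]" by (rule degree_eq_zeroE)
  from d have "b dvd coeff p i" "b dvd c"
    unfolding b by (simp add: const_poly_dvd_iff, simp)
  with assms(2) show "d dvd 1" unfolding b by (simp add: is_unit_const_poly_iff) (metis coprime_common_divisor)
qed

section \<open>The factor g and the two indeterminates\<close>

definition wp_factor :: "'a :: field \<Rightarrow> 'a \<Rightarrow> 'a" where
  "wp_factor a x = (1 - a * x) * (1 - x / a) * (1 - x ^ 2)"

text \<open>The case \<open>x y = 1\<close> is the functional equation of \<^const>\<open>wp_factor\<close> under \<open>x \<mapsto> 1 / x\<close>. Keeping
  \<open>x y\<close> makes the identity usable modulo \<open>\<Phi>\<^sub>n(q)\<close>, where \<open>q\<^sup>i q\<^sup>j = q\<^sup>n \<equiv> 1\<close>.\<close>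

lemma wp_factor_reflect:
  fixes a x y :: "'a :: field"
  assumes "a \<noteq> 0"
  shows "x ^ 4 * wp_factor a y = (x - a * (x * y)) * (x - x * y / a) * (x ^ 2 - (x * y) ^ 2)"
  using assms by (simp add: wp_factor_def field_simps power2_eq_square power4_eq_xxxx)

lemma qvar_eq: "qvar = to_fract [:[:0, 1:]:]"
  by (simp add: qvar_def to_fract_def)

lemma qvar_power: "qvar ^ j = to_fract [:monom 1 j:]"
proof (induction j)
  case 0
  show ?case by (simp add: one_pCons flip: to_fract_1)
next
  case (Suc j)
  have "qvar ^ Suc j = to_fract ([:[:0, 1:]:] * [:monom 1 j:])"
    unfolding power_Suc Suc unfolding qvar_eq to_fract_mult ..
  thus ?case by (simp add: monom_Suc del: to_fract_mult)
qed

lemma avar_eq: "avar = to_fract [:0, 1:]"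
  by (simp add: avar_def to_fract_def)

lemma avar_nonzero [simp]: "avar \<noteq> 0"
  by (simp add: avar_eq)

lemma regular_at_qvar [simp]: "regular_at P qvar"
  by (simp add: qvar_eq)

lemma regular_at_avar [simp]: "regular_at P avar"
  by (simp add: avar_eq)

lemma cyclotomic_nonzero [simp]: "cyclotomic n \<noteq> 0"
  using lead_coeff_cyclotomic[of n] by auto

lemma regular_at_inverse_avar [simp]: "regular_at [:cyclotomic n:] (inverse avar)"
  unfolding avar_eq
  by (intro regular_at_inverse_to_fract coprime_const_polyI[of _ _ 1]) simp_all

lemma cong_mod_qvar_power:
  assumes "n > 0"
  shows   "cong_mod [:cyclotomic n:] (qvar ^ n) 1"
proof -
  from cyclotomic_dvd[OF assms] obtain e where "monom 1 n - 1 = cyclotomic n * e" ..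
  hence "[:monom 1 n:] - 1 = [:cyclotomic n:] * [:e:]"
    by (simp add: one_pCons)
  hence "qvar ^ n - 1 = to_fract [:cyclotomic n:] * to_fract [:e:]"
    unfolding qvar_power to_fract_mult[symmetric] by (metis to_fract_1 to_fract_diff)
  thus ?thesis unfolding cong_mod_def using regular_at_to_fract by blast
qed

section \<open>The summands as products of ratios\<close>

abbreviation "G j \<equiv> wp_factor avar (qvar ^ j)"

text \<open>Defined through its successive ratios, because the reflection argument compares these;
  \<open>qterm_eq\<close> identifies it with the summand.\<close>

definition qterm :: "nat \<Rightarrow> ratfun" where
  "qterm k = (\<Prod>j<k. qvar ^ 2 * (G (2 * j + 1) / G (2 * j + 2)))"

lemma qterm_Suc: "qterm (Suc k) = qterm k * (qvar ^ 2 * (G (2 * k + 1) / G (2 * k + 2)))"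
  by (simp add: qterm_def)

text \<open>The three factors of g(q^(2j+1)) are the j-th factors of the numerator products, those
  of g(q^(2j+2)) the ones of the denominator. The factor 1 - x^2 produces the base q^4.\<close>

lemma qterm_eq:
  "qterm k = (qpoch (avar * qvar) (qvar ^ 2) k * qpoch (qvar / avar) (qvar ^ 2) k *
       qpoch (qvar ^ 2) (qvar ^ 4) k) /
     (qpoch (avar * qvar ^ 2) (qvar ^ 2) k * qpoch (qvar ^ 2 / avar) (qvar ^ 2) k *
       qpoch (qvar ^ 4) (qvar ^ 4) k) * qvar ^ (2 * k)"
proof -
  have 1: "wp_factor avar (qvar ^ (2 * j + 1)) = (1 - avar * qvar * (qvar ^ 2) ^ j) *
      (1 - qvar / avar * (qvar ^ 2) ^ j) * (1 - qvar ^ 2 * (qvar ^ 4) ^ j)" for j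
    using arg_cong[of "qvar ^ (2 * j + 1)" "qvar * (qvar ^ 2) ^ j" "wp_factor avar"]
    by (simp add: wp_factor_def power_mult_distrib mult_ac flip: power_mult)
  have 2: "wp_factor avar (qvar ^ (2 * j + 2)) = (1 - avar * qvar ^ 2 * (qvar ^ 2) ^ j) *
      (1 - qvar ^ 2 / avar * (qvar ^ 2) ^ j) * (1 - qvar ^ 4 * (qvar ^ 4) ^ j)" for j
  proof -
    have "qvar ^ (2 * j + 2) = qvar ^ 2 * (qvar ^ 2) ^ j"
      by (simp only: power_add power_mult) (rule mult.commute)
    moreover have "(qvar ^ 2 * (qvar ^ 2) ^ j) ^ 2 = qvar ^ 4 * (qvar ^ 4) ^ j"
      by (simp add: power_mult_distrib mult_ac flip: power_mult)
    ultimately show ?thesis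
      by (simp only: wp_factor_def) (simp only: mult_ac times_divide_eq_left times_divide_eq_right)
  qed
  show ?thesis
    unfolding qterm_def 1 2 qpoch_def
    by (simp add: prod.distrib prod_dividef power_mult)
qed

section \<open>Reflection modulo Phi_n for odd n\<close>

context
  fixes n :: nat
  assumes odd: "odd n"
begin

lemma regular_at_wp_factor: "regular_at [:cyclotomic n:] (G j)"
  unfolding wp_factor_def divide_inverse
  by (intro regular_at_mult regular_at_diff regular_at_power) simp_all

lemma n_pos: "n > 0"
  using odd by (rule odd_pos)

text \<open>After clearing 1/a, the first two factors of g are polynomials in a with a coefficient
  1, hence coprime to Phi_n. For the third, 1 - q^(2j), oddness of n enters: n does not divide
  2j.\<close>

lemma wp_factor_inverse:
  assumes "0 < j" "j < n"
  shows   "regular_at [:cyclotomic n:] (inverse (G j))" and "G j \<noteq> 0"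
proof -
  let ?u = "[:1, - monom 1 j:] :: int poly poly" and ?v = "[:- monom 1 j, 1:] :: int poly poly"
    and ?w = "[:1 - monom 1 (2 * j):] :: int poly poly"
  have *: "\<not> n dvd 2 * j"
  proof
    assume "n dvd 2 * j"
    hence "n dvd j" using odd by (simp add: coprime_dvd_mult_right_iff)
    thus False using assms by (auto dest: dvd_imp_le)
  qed
  have u: "coprime ?u [:cyclotomic n:]"
    by (rule coprime_const_polyI[of _ _ 0]) simp_all
  have v: "coprime ?v [:cyclotomic n:]"
    by (rule coprime_const_polyI[of _ _ 1]) simp_all
  have w: "coprime ?w [:cyclotomic n:]"
    by (rule coprime_const_polyI[of _ _ 0]) (simp_all add: coprime_monom_diff_cyclotomic n_pos *)
  have u': "1 - avar * qvar ^ j = to_fract ?u"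
    unfolding avar_eq qvar_power to_fract_mult[symmetric] to_fract_1[symmetric] to_fract_diff[symmetric]
    by (simp add: one_pCons)
  have v': "1 - qvar ^ j / avar = to_fract ?v / avar"
  proof -
    have "avar - qvar ^ j = to_fract ?v"
      unfolding avar_eq qvar_power to_fract_diff[symmetric] by simp
    moreover have "1 - qvar ^ j / avar = (avar - qvar ^ j) / avar" by (simp add: field_simps)
    ultimately show ?thesis by simp
  qed
  have w': "1 - (qvar ^ j) ^ 2 = to_fract ?w"
    unfolding power_mult[symmetric] unfolding qvar_power to_fract_1[symmetric] to_fract_diff[symmetric]
    by (simp add: one_pCons mult.commute)
  have G: "G j = to_fract ?u * (to_fract ?v / avar) * to_fract ?w"
    unfolding wp_factor_def u' v' w' ..
  have "inverse (G j) = inverse (to_fract ?u) * (inverse (to_fract ?v) * avar) * inverse (to_fract ?w)"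
    unfolding G by (simp add: divide_inverse mult_ac)
  thus "regular_at [:cyclotomic n:] (inverse (G j))"
    using u v w
    by (simp only:) (intro regular_at_mult regular_at_inverse_to_fract regular_at_avar)
  have "coeff (1 - monom 1 (2 * j) :: int poly) 0 = 1"
    using assms by simp
  hence "1 - monom 1 (2 * j) \<noteq> (0 :: int poly)"
    by (intro notI) simp
  thus "G j \<noteq> 0" unfolding G by simp
qed

text \<open>With x y replaced by 1, \<open>wp_factor_reflect\<close> gives x^4 g(y) = (x - a) (x -
  1/a) (x^2 - 1) = - g(x); it remains to divide by g(y), whose inverse is regular.\<close>

lemma wp_factor_ratio:
  assumes "i + j = n" "0 < i" "0 < j"
  shows   "cong_mod [:cyclotomic n:] (G i / G j) (- (qvar ^ (4 * i)))"
proof -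
  let ?P = "[:cyclotomic n:]"
  define x y where "x = qvar ^ i" and "y = qvar ^ j"
  have reg: "regular_at ?P x" "regular_at ?P y" "regular_at ?P (inverse avar)"
    unfolding x_def y_def by (intro regular_at_power regular_at_qvar regular_at_inverse_avar)+
  have xy: "cong_mod ?P (x * y) 1"
    using cong_mod_qvar_power[OF n_pos] assms(1) by (simp add: x_def y_def flip: power_add)
  have 1: "cong_mod ?P (x - avar * (x * y)) (x - avar)"
    using cong_mod_diff[OF cong_mod_refl cong_mod_mult_right[OF xy regular_at_avar], of x]
    by (simp add: mult.commute)
  have 2: "cong_mod ?P (x - x * y / avar) (x - 1 / avar)"
    using cong_mod_diff[OF cong_mod_refl cong_mod_mult_right[OF xy reg(3)], of x]
    by (simp add: divide_inverse)
  \<comment> \<open>The unevaluated \<open>1 ^ 2\<close> matches the form of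
    \<open>cong_mod_power\<close>.\<close>
  have 3: "cong_mod ?P (x ^ 2 - (x * y) ^ 2) (x ^ 2 - 1 ^ 2)"
    using reg by (intro cong_mod_diff cong_mod_power cong_mod_refl xy regular_at_mult regular_at_1)
  have "cong_mod ?P (x ^ 4 * G j) ((x - avar) * (x - 1 / avar) * (x ^ 2 - 1 ^ 2))"
    unfolding y_def[symmetric] wp_factor_reflect[OF avar_nonzero]
    unfolding divide_inverse using reg
    by (intro cong_mod_mult 1[unfolded divide_inverse] 2[unfolded divide_inverse] 3
      regular_at_intros regular_at_1 regular_at_avar)
  also have "(x - avar) * (x - 1 / avar) * (x ^ 2 - 1 ^ 2) = - G i"
    by (simp add: wp_factor_def x_def[symmetric] field_simps)
  finally have "cong_mod ?P (x ^ 4 * G j * inverse (G j)) (- G i * inverse (G j))"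
    using assms by (intro cong_mod_mult_right wp_factor_inverse(1)) auto
  hence "cong_mod ?P (x ^ 4) (- (G i / G j))"
    using wp_factor_inverse(2)[of j] assms by (simp add: divide_inverse mult.assoc)
  from cong_mod_sym[OF cong_mod_uminus[OF this]] show ?thesis
    by (simp add: x_def mult.commute flip: power_mult)
qed

text \<open>The exponents in the denominators are 2, 4, ..., 2k, all positive and below n.\<close>

lemma regular_at_qterm:
  assumes "2 * k < n"
  shows   "regular_at [:cyclotomic n:] (qterm k)"
  unfolding qterm_def divide_inverse
  using assms by (intro regular_at_prod regular_at_mult regular_at_power regular_at_wp_factor
    wp_factor_inverse(1)) auto

lemma regular_at_ratio:
  assumes "0 < j" "j < n"
  shows   "regular_at [:cyclotomic n:] (G i / G j)"
  unfolding divide_inverse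
  using assms by (intro regular_at_mult regular_at_wp_factor wp_factor_inverse(1))

text \<open>Induction outwards from the centre. Each step multiplies by the ratios at l = m + 1 + i
  and k = m - i - 1; since l + k = 2m, the odd exponent of either ratio and the even exponent of the
  other add up to n.\<close>

lemma qterm_reflect:
  assumes n: "n = 4 * m + 3" and "i \<le> m"
  shows   "cong_mod [:cyclotomic n:] (qterm (m + 1 + i)) (- qterm (m - i))"
  using \<open>i \<le> m\<close>
proof (induction i)
  case 0
  let ?P = "[:cyclotomic n:]"
  have reg: "regular_at ?P (qterm m)" using n by (intro regular_at_qterm) auto
  have "cong_mod ?P (G (2 * m + 1) / G (2 * m + 2) * (qvar ^ 2 * qterm m))
      (- (qvar ^ (4 * (2 * m + 1))) * (qvar ^ 2 * qterm m))"
    by (intro cong_mod_mult_right wp_factor_ratio regular_at_intros reg regular_at_qvar) (use n in auto)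
  also have "G (2 * m + 1) / G (2 * m + 2) * (qvar ^ 2 * qterm m) = qterm (m + 1)"
    by (simp add: qterm_Suc)
  \<comment> \<open>The exponent is 4 (2m + 1) + 2 = 2n.\<close>
  also have "- (qvar ^ (4 * (2 * m + 1))) * (qvar ^ 2 * qterm m) =
      (qvar ^ n) ^ 2 * (- qterm m)"
    by (simp add: n algebra_simps flip: power_add power_mult)
  also have "cong_mod ?P \<dots> (1 ^ 2 * (- qterm m))"
    by (intro cong_mod_mult_right cong_mod_power cong_mod_qvar_power n_pos regular_at_intros reg
      regular_at_1 regular_at_qvar)
  finally show ?case by simp
next
  case (Suc i)
  let ?P = "[:cyclotomic n:]"
  define k where "k = m - Suc i"
  have m: "m = k + Suc i" and mi: "m - i = Suc k" "m - Suc i = k" using Suc.prems by (auto simp: k_def)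
  let ?l = "m + 1 + i"
  have reg: "regular_at ?P (qterm k)" using n m by (intro regular_at_qterm) auto
  let ?r = "G (2 * ?l + 1) / G (2 * ?l + 2)"
  have 1: "cong_mod ?P (G (2 * ?l + 1) / G (2 * k + 2)) (- (qvar ^ (4 * (2 * ?l + 1))))"
    by (intro wp_factor_ratio) (use n m in auto)
  have 2: "cong_mod ?P (G (2 * k + 1) / G (2 * ?l + 2)) (- (qvar ^ (4 * (2 * k + 1))))"
    by (intro wp_factor_ratio) (use n m in auto)
  have regr: "regular_at ?P ?r" "regular_at ?P (G (2 * k + 1) / G (2 * ?l + 2))"
    by (intro regular_at_ratio; use n m in simp)+
  have "cong_mod ?P (qterm ?l * (qvar ^ 2 * ?r)) (- qterm (Suc k) * (qvar ^ 2 * ?r))"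
    using Suc regr(1) unfolding mi
    by (intro cong_mod_mult_right regular_at_mult regular_at_power regular_at_qvar) auto
  also have "qterm ?l * (qvar ^ 2 * ?r) = qterm (m + 1 + Suc i)"
    using qterm_Suc[of ?l] by simp
  \<comment> \<open>Exchanging the denominators of the two ratios makes
    \<open>wp_factor_ratio\<close> applicable to each quotient.\<close>
  also have "- qterm (Suc k) * (qvar ^ 2 * ?r) =
      (G (2 * ?l + 1) / G (2 * k + 2)) * (G (2 * k + 1) / G (2 * ?l + 2)) * (- (qvar ^ 4 * qterm k))"
    by (simp add: qterm_Suc power2_eq_square power4_eq_xxxx)
  also have "cong_mod ?P \<dots> ((- (qvar ^ (4 * (2 * ?l + 1)))) * (- (qvar ^ (4 * (2 * k + 1)))) *
      (- (qvar ^ 4 * qterm k)))"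
    by (intro cong_mod_mult_right cong_mod_mult 1 2 regr regular_at_intros reg regular_at_qvar)
  \<comment> \<open>The exponent is 8 (l + k) + 12 = 16m + 12 = 4n, and three minus signs leave
    one.\<close>
  also have "\<dots> = (qvar ^ n) ^ 4 * (- qterm k)"
    by (simp add: n m algebra_simps flip: power_add power_mult)
  also have "cong_mod ?P \<dots> (1 ^ 4 * (- qterm k))"
    by (intro cong_mod_mult_right cong_mod_power cong_mod_qvar_power n_pos regular_at_intros reg
      regular_at_1 regular_at_qvar)
  finally show ?case by (simp add: mi)
qed

end

section \<open>Cancellation of the sum in pairs\<close>

theorem theorem3p2:
  fixes n :: nat and q a :: ratfun
  assumes "n mod 4 = 3"
  defines "q \<equiv> qvar" and "a \<equiv> avar"
  shows "ratfun_cong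
    (\<Sum>k = 0..(n - 1) div 2.
       (qpoch (a * q) (q ^ 2) k * qpoch (q / a) (q ^ 2) k * qpoch (q ^ 2) (q ^ 4) k) /
       (qpoch (a * q ^ 2) (q ^ 2) k * qpoch (q ^ 2 / a) (q ^ 2) k * qpoch (q ^ 4) (q ^ 4) k) *
       q ^ (2 * k))
    0 [:cyclotomic n:]"
proof -
  define m where "m = n div 4"
  have n: "n = 4 * m + 3" using assms(1) unfolding m_def by presburger
  hence "odd n" by simp
  \<comment> \<open>Here (n - 1) div 2 = 2m + 1, so there are 2m + 2 terms: two halves of equal
    length.\<close>
  have "(\<Sum>k = 0..(n - 1) div 2. qterm k) = (\<Sum>k<Suc m + Suc m. qterm k)"
    using n by (intro sum.cong) auto
  \<comment> \<open>The first half is reversed so that equal indices meet reflected terms.\<close>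
  also have "\<dots> = (\<Sum>i<Suc m. qterm (m - i)) + (\<Sum>i<Suc m. qterm (m + 1 + i))"
  proof -
    have "(\<Sum>k<Suc m + Suc m. qterm k) = (\<Sum>k<Suc m. qterm k) + (\<Sum>k<Suc m. qterm (k + Suc m))"
      using sum.atLeastLessThan_concat[of 0 "Suc m" "Suc m + Suc m" qterm]
        sum.shift_bounds_nat_ivl[of qterm 0 "Suc m" "Suc m"]
      by (simp only: atLeast0LessThan add_0 le_add1 zero_le)
    thus ?thesis using sum.nat_diff_reindex[of qterm "Suc m"] by (simp add: add_ac)
  qed
  finally have eq: "(\<Sum>k = 0..(n - 1) div 2. qterm k) =
      (\<Sum>i<Suc m. qterm (m - i) + qterm (m + 1 + i))" by (simp add: sum.distrib)
  have "cong_mod [:cyclotomic n:] (\<Sum>i<Suc m. qterm (m - i) + qterm (m + 1 + i))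
      (\<Sum>i<Suc m. qterm (m - i) + - qterm (m - i))"
    by (intro cong_mod_sum cong_mod_add cong_mod_refl qterm_reflect) (use n in auto)
  thus ?thesis unfolding q_def a_def qterm_eq[symmetric] eq
    by (intro ratfun_cong_0I) simp
qed

end
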